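(* Let $\mathcal{M}=M_n(\mathbb{C})$ and let $\phi$ be a faithful normal state on $\mathcal{M}$. An extremal element $\psi$ of $C_\phi$ is a pure state (of $\mathcal{M}\otimes\mathcal{M}$) if and only if $\tau_\psi$ is an automorphism of $\mathcal{M}$.
   Context: $C_\phi$ is the convex set of states $\psi$ on $\mathcal{M}\otimes\mathcal{M}$ whose restrictions to $\mathcal{M}\otimes I$ and to $I\otimes\mathcal{M}$ are both equal to $\phi$. $\mathcal{M}$ is taken in its standard form associated with $\phi$: it acts on a Hilbert space (inner product linear in the second variable) with a cyclic and separating vector $\Omega$ such that $\phi(x)=\langle\Omega,x\Omega\rangle$, and $\mathcal{J}$ is Tomita's conjugation operator, from the polar decomposition $S=\mathcal{J}\Delta^{1/2}$ of the closure $S$ of $x\Omega\mapsto x^*\Omega$. For $\psi\in C_\phi$, $\tau_\psi:\mathcal{M}\to\mathcal{M}$ is the map determined by $$\psi(x\otimes y)=\langle\mathcal{J}x\mathcal{J}\Omega,\tau_\psi(y)\Omega\rangle,\qquad x,y\in\mathcal{M}.$$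
   Formalization: "Automorphism" is read as Jordan *-automorphism (so antiautomorphisms count): with the given conventions the multiplicative reading is false, since for n≥2 the maximally entangled pure state with φ the trace has τ_ψ equal to the transpose. *)

theory Defs
  imports "HOL-Analysis.Analysis"
begin

subsection \<open>The algebra of complex matrices\<close>

definition cscale :: "complex \<Rightarrow> complex^'a^'b \<Rightarrow> complex^'a^'b" where
  "cscale c A = (\<chi> i j. c * A $ i $ j)"

definition adj :: "complex^'a^'b \<Rightarrow> complex^'b^'a" where
  "adj A = (\<chi> i j. cnj (A $ j $ i))"

text \<open>The tensor product of two full matrix algebras is the full matrix algebra over the
  product of the index types; \<open>kron x y\<close> is the elementary tensor of \<open>x\<close> and \<open>y\<close>.\<close>

definition kron :: "complex^'a^'a \<Rightarrow> complex^'b^'b \<Rightarrow> complex^('a \<times> 'b)^('a \<times> 'b)" where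
  "kron x y = (\<chi> p q. x $ fst p $ fst q * y $ snd p $ snd q)"

text \<open>Linear in the second variable.\<close>

definition cinner :: "complex^'h \<Rightarrow> complex^'h \<Rightarrow> complex" where
  "cinner u v = (\<Sum>i\<in>UNIV. cnj (u $ i) * v $ i)"

subsection \<open>States\<close>

text \<open>Elements of the blinfun type are the real-linear continuous functionals, so complex
  homogeneity has to be required separately. On a finite-dimensional algebra the norm topology
  and the ultraweak topology coincide: continuity is normality.\<close>

definition is_state :: "((complex^'k^'k) \<Rightarrow>\<^sub>L complex) \<Rightarrow> bool" where
  "is_state \<psi> \<longleftrightarrow>
     (\<forall>c a. blinfun_apply \<psi> (cscale c a) = c * blinfun_apply \<psi> a) \<and>
     (\<forall>a :: complex^'k^'k. blinfun_apply \<psi> (adj a ** a) \<in> \<real>\<^sub>\<ge>\<^sub>0) \<and>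
     blinfun_apply \<psi> (mat 1) = 1"

definition faithful_state :: "((complex^'k^'k) \<Rightarrow>\<^sub>L complex) \<Rightarrow> bool" where
  "faithful_state \<phi> \<longleftrightarrow>
     is_state \<phi> \<and> (\<forall>a :: complex^'k^'k. blinfun_apply \<phi> (adj a ** a) = 0 \<longrightarrow> a = 0)"

definition pure_state :: "((complex^'k^'k) \<Rightarrow>\<^sub>L complex) \<Rightarrow> bool" where
  "pure_state \<psi> \<longleftrightarrow> \<psi> extreme_point_of {\<omega>. is_state \<omega>}"

definition couplings ::
  "((complex^'n^'n) \<Rightarrow>\<^sub>L complex) \<Rightarrow> ((complex^('n \<times> 'n)^('n \<times> 'n)) \<Rightarrow>\<^sub>L complex) set" where
  "couplings \<phi> = {\<psi>. is_state \<psi> \<and>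
     (\<forall>x. blinfun_apply \<psi> (kron x (mat 1)) = blinfun_apply \<phi> x) \<and>
     (\<forall>y. blinfun_apply \<psi> (kron (mat 1) y) = blinfun_apply \<phi> y)}"

subsection \<open>Standard form and Tomita conjugation\<close>

definition unital_star_hom :: "(complex^'n^'n \<Rightarrow> complex^'h^'h) \<Rightarrow> bool" where
  "unital_star_hom \<pi> \<longleftrightarrow>
     (\<forall>x y. \<pi> (x + y) = \<pi> x + \<pi> y) \<and>
     (\<forall>c x. \<pi> (cscale c x) = cscale c (\<pi> x)) \<and>
     (\<forall>x y. \<pi> (x ** y) = \<pi> x ** \<pi> y) \<and>
     (\<forall>x. \<pi> (adj x) = adj (\<pi> x)) \<and>
     \<pi> (mat 1) = mat 1"

text \<open>A cyclic vector for a matrix algebra forces the Hilbert space to be finite-dimensional, so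
  the coordinate spaces \<open>complex^'h\<close> cover every standard form up to unitary equivalence.\<close>

definition standard_form ::
  "((complex^'n^'n) \<Rightarrow>\<^sub>L complex) \<Rightarrow> (complex^'n^'n \<Rightarrow> complex^'h^'h) \<Rightarrow> complex^'h \<Rightarrow> bool" where
  "standard_form \<phi> \<pi> \<Omega> \<longleftrightarrow>
     unital_star_hom \<pi> \<and>
     closure (range (\<lambda>x. \<pi> x *v \<Omega>)) = UNIV \<and>
     (\<forall>x. \<pi> x *v \<Omega> = 0 \<longrightarrow> x = 0) \<and>
     (\<forall>x. blinfun_apply \<phi> x = cinner \<Omega> (\<pi> x *v \<Omega>))"

definition antiunitary :: "(complex^'h \<Rightarrow> complex^'h) \<Rightarrow> bool" where
  "antiunitary J \<longleftrightarrow> bij J \<and>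
     (\<forall>u v. J (u + v) = J u + J v) \<and>
     (\<forall>c u. J (c *s u) = cnj c *s J u) \<and>
     (\<forall>u v. cinner (J u) (J v) = cinner v u)"

definition positive_operator :: "complex^'h^'h \<Rightarrow> bool" where
  "positive_operator D \<longleftrightarrow> (\<forall>u. cinner u (D *v u) \<in> \<real>\<^sub>\<ge>\<^sub>0)"

text \<open>The closure below is the graph of the closed operator \<open>S\<close>, and \<open>D\<close> is the factor
  \<open>\<Delta>\<^bsup>1/2\<^esup>\<close> in its polar decomposition. The antilinear factor is antiunitary because \<open>S\<close> is
  injective with dense range.\<close>

definition tomita_conjugation ::
  "(complex^'n^'n \<Rightarrow> complex^'h^'h) \<Rightarrow> complex^'h \<Rightarrow> (complex^'h \<Rightarrow> complex^'h) \<Rightarrow> bool" where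
  "tomita_conjugation \<pi> \<Omega> J \<longleftrightarrow> antiunitary J \<and>
     (\<exists>D. positive_operator D \<and>
          closure (range (\<lambda>x. (\<pi> x *v \<Omega>, \<pi> (adj x) *v \<Omega>))) = range (\<lambda>u. (u, J (D *v u))))"

definition coupling_map ::
  "(complex^'n^'n \<Rightarrow> complex^'h^'h) \<Rightarrow> complex^'h \<Rightarrow> (complex^'h \<Rightarrow> complex^'h) \<Rightarrow>
   ((complex^('n \<times> 'n)^('n \<times> 'n)) \<Rightarrow>\<^sub>L complex) \<Rightarrow> complex^'n^'n \<Rightarrow> complex^'n^'n" where
  "coupling_map \<pi> \<Omega> J \<psi> = (THE \<tau>. \<forall>x y.
     blinfun_apply \<psi> (kron x y) = cinner (J (\<pi> x *v J \<Omega>)) (\<pi> (\<tau> y) *v \<Omega>))"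

subsection \<open>Automorphisms\<close>

text \<open>The maps \<open>coupling_map \<pi> \<Omega> J \<psi>\<close> are unital and positive, and the invertible morphisms of
  that kind are the automorphisms of the matrix algebra for its involution and its Jordan product
  \<open>(xy + yx)/2\<close>, that is, the star-automorphisms and the star-antiautomorphisms.
  Antimultiplicative maps cannot be excluded: since \<open>x \<mapsto> J x J\<close> is a conjugate-linear homomorphism
  and the inner product is conjugate-linear in its first variable, positivity of \<open>\<psi>\<close> makes
  \<open>coupling_map \<pi> \<Omega> J \<psi>\<close> completely copositive. In dimension at least two it is then never a
  multiplicative bijection, whereas for every pure coupling it is an antiautomorphism (the
  transpose, if \<open>\<psi>\<close> is the maximally entangled state and \<open>\<phi>\<close> the trace).\<close>

definition jordan_star_automorphism :: "(complex^'n^'n \<Rightarrow> complex^'n^'n) \<Rightarrow> bool" where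
  "jordan_star_automorphism \<tau> \<longleftrightarrow> bij \<tau> \<and>
     (\<forall>x y. \<tau> (x + y) = \<tau> x + \<tau> y) \<and>
     (\<forall>c x. \<tau> (cscale c x) = cscale c (\<tau> x)) \<and>
     (\<forall>x. \<tau> (adj x) = adj (\<tau> x)) \<and>
     (\<forall>x y. \<tau> (x ** y + y ** x) = \<tau> x ** \<tau> y + \<tau> y ** \<tau> x)"

end

theory Submission
  imports Defs
begin

text \<open>Write \<open>\<phi>(x) = Tr(r\<^sup>2 x)\<close> with \<open>r\<close> positive definite. Then \<open>\<J> x\<Omega> = r x\<^sup>* r\<^sup>-\<^sup>1 \<Omega>\<close>, so that
  \<open>\<psi>(x \<otimes> y) = Tr(r x r \<tau>(y))\<close> for \<open>\<tau> = \<tau>\<^sub>\<psi>\<close>. A pure \<open>\<psi>\<close> is the state of a unit vector, that is, of a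
  matrix \<open>V\<close> with \<open>V V\<^sup>* = r\<^sup>2\<close> by the marginal condition; hence \<open>U = r\<^sup>-\<^sup>1 V\<close> is unitary and
  \<open>\<tau>(y) = U y\<^sup>T U\<^sup>*\<close>. Conversely, if \<open>\<tau>\<close> is a Jordan automorphism, then
  \<open>a = 1 \<otimes> y - r \<tau>(y) r\<^sup>-\<^sup>1 \<otimes> 1\<close> satisfies \<open>\<psi>(a\<^sup>* a) = 0\<close> for self-adjoint \<open>y\<close>. The same holds for each
  state \<open>\<alpha>\<close> in a convex decomposition of \<open>\<psi>\<close>. This forces \<open>\<alpha>(x \<otimes> y) = \<alpha>(x r \<tau>(y) r\<^sup>-\<^sup>1 \<otimes> 1)\<close> and
  the KMS condition for the first marginal of \<open>\<alpha>\<close>, which is therefore \<open>\<phi>\<close>; so \<open>\<alpha> = \<psi>\<close>.\<close>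

subsection \<open>Complex matrices\<close>

lemma adj_nth: "adj A $ i $ j = cnj (A $ j $ i)"
  by (simp add: adj_def)

lemma cscale_nth: "cscale c A $ i $ j = c * A $ i $ j"
  by (simp add: cscale_def)

lemma kron_nth: "kron x y $ p $ q = x $ fst p $ fst q * y $ snd p $ snd q"
  by (simp add: kron_def)

lemma matrix_mult_nth: "(A ** B) $ i $ j = (\<Sum>k\<in>UNIV. A $ i $ k * B $ k $ j)"
  by (simp add: matrix_matrix_mult_def)

lemma mat_1_nth: "(mat 1 :: complex^'a^'a) $ i $ j = (if i = j then 1 else 0)"
  by (simp add: mat_def)

lemma matrix_ext: "(\<And>i j. A $ i $ j = B $ i $ j) \<Longrightarrow> A = B"
  by (simp add: vec_eq_iff)

lemma adj_adj [simp]: "adj (adj A) = A"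
  by (rule matrix_ext) (simp add: adj_nth)

lemma adj_add: "adj (A + B) = adj A + adj B"
  by (rule matrix_ext) (simp add: adj_nth)

lemma adj_diff: "adj (A - B) = adj A - adj B"
  by (rule matrix_ext) (simp add: adj_nth)

lemma adj_cscale: "adj (cscale c A) = cscale (cnj c) (adj A)"
  by (rule matrix_ext) (simp add: adj_nth cscale_nth)

lemma adj_mat_1 [simp]: "adj (mat 1) = mat 1"
  by (rule matrix_ext) (simp add: adj_nth mat_1_nth)

lemma adj_zero [simp]: "adj 0 = 0"
  by (rule matrix_ext) (simp add: adj_nth)

lemma adj_mult: "adj (A ** B) = adj B ** adj A"
  by (rule matrix_ext) (simp add: adj_nth matrix_mult_nth mult.commute)

lemma matrix_zero_mult [simp]: "(0 :: complex^'a^'b) ** B = 0" "B' ** (0 :: complex^'a^'b) = 0"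
  by (rule matrix_ext, simp add: matrix_mult_nth)+

lemma matrix_diff_ldistrib: "(A :: complex^'a^'b) ** (B - C) = A ** B - A ** C"
  by (rule matrix_ext) (simp add: matrix_mult_nth algebra_simps sum_subtractf)

lemma matrix_diff_rdistrib: "((B :: complex^'a^'b) - C) ** A = B ** A - C ** A"
  by (rule matrix_ext) (simp add: matrix_mult_nth algebra_simps sum_subtractf)

lemma matrix_plus_ldistrib: "(A :: complex^'a^'b) ** (B + C) = A ** B + A ** C"
  by (rule matrix_ext) (simp add: matrix_mult_nth algebra_simps sum.distrib)

lemma matrix_plus_rdistrib: "((B :: complex^'a^'b) + C) ** A = B ** A + C ** A"
  by (rule matrix_ext) (simp add: matrix_mult_nth algebra_simps sum.distrib)

lemma cscale_mult_left: "cscale c A ** B = cscale c (A ** B)"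
  by (rule matrix_ext) (simp add: matrix_mult_nth cscale_nth sum_distrib_left mult.assoc)

lemma cscale_mult_right: "A ** cscale c B = cscale c (A ** B)"
  by (rule matrix_ext) (simp add: matrix_mult_nth cscale_nth sum_distrib_left algebra_simps)

lemma cscale_cscale [simp]: "cscale c (cscale d A) = cscale (c * d) A"
  by (rule matrix_ext) (simp add: cscale_nth)

lemma cscale_one [simp]: "cscale 1 A = A"
  by (rule matrix_ext) (simp add: cscale_nth)

lemma cscale_add: "cscale c (A + B) = cscale c A + cscale c B"
  by (rule matrix_ext) (simp add: cscale_nth algebra_simps)

lemma scaleR_eq_cscale: "r *\<^sub>R A = cscale (of_real r) A"
  by (rule matrix_ext) (simp only: cscale_nth vector_scaleR_component, simp add: scaleR_conv_of_real)

lemma scaleR_eq_smult: "r *\<^sub>R v = (of_real r :: complex) *s v"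
  by (simp only: vec_eq_iff vector_scaleR_component vector_smult_component)
    (simp add: scaleR_conv_of_real)

lemma adj_scaleR: "adj (r *\<^sub>R A) = r *\<^sub>R adj A"
  unfolding scaleR_eq_cscale adj_cscale by simp

lemma trace_cscale: "trace (cscale c A) = c * trace A"
  by (simp add: trace_def cscale_nth sum_distrib_left)

lemma kron_mult: "kron a b ** kron c d = kron (a ** c) (b ** d)"
proof (rule matrix_ext)
  fix p q
  have "(kron a b ** kron c d) $ p $ q = (\<Sum>(k, l)\<in>UNIV \<times> UNIV.
      (a $ fst p $ k * c $ k $ fst q) * (b $ snd p $ l * d $ l $ snd q))"
    by (simp add: matrix_mult_nth kron_nth case_prod_beta mult_ac)
  also have "\<dots> = kron (a ** c) (b ** d) $ p $ q"
    by (simp only: sum.cartesian_product [symmetric] matrix_mult_nth kron_nth sum_product)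
  finally show "(kron a b ** kron c d) $ p $ q = kron (a ** c) (b ** d) $ p $ q" .
qed

lemma kron_add_left: "kron (a + b) c = kron a c + kron b c"
  by (rule matrix_ext) (simp add: kron_nth algebra_simps)

lemma kron_add_right: "kron a (b + c) = kron a b + kron a c"
  by (rule matrix_ext) (simp add: kron_nth algebra_simps)

lemma kron_cscale_left: "kron (cscale k a) c = cscale k (kron a c)"
  by (rule matrix_ext) (simp add: kron_nth cscale_nth)

lemma kron_cscale_right: "kron a (cscale k c) = cscale k (kron a c)"
  by (rule matrix_ext) (simp add: kron_nth cscale_nth)

lemma adj_kron: "adj (kron a b) = kron (adj a) (adj b)"
  by (rule matrix_ext) (simp add: kron_nth adj_nth)

lemma kron_mat_1: "kron (mat 1) (mat 1) = mat 1"
  by (rule matrix_ext) (auto simp add: kron_nth mat_1_nth prod_eq_iff)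

definition matrix_unit :: "'a \<Rightarrow> 'b \<Rightarrow> complex^'b^'a" where
  "matrix_unit i j = (\<chi> a b. if a = i \<and> b = j then 1 else 0)"

lemma matrix_unit_nth: "matrix_unit i j $ a $ b = (if a = i \<and> b = j then 1 else 0)"
  by (simp add: matrix_unit_def)

lemma sum_delta_conj:
  fixes f :: "'a::finite \<Rightarrow> complex"
  shows "(\<Sum>k\<in>UNIV. if k = i \<and> P then f k else 0) = (if P then f i else 0)"
    "(\<Sum>k\<in>UNIV. if P \<and> k = i then f k else 0) = (if P then f i else 0)"
  by (cases P; simp)+

lemma trace_matrix_unit: "trace (A ** matrix_unit i j) = A $ j $ i"
  by (simp add: trace_def matrix_mult_nth matrix_unit_nth if_distrib [of "(*) _"] sum_delta_conj
      cong: if_cong)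

lemma matrix_eq_trace:
  fixes A B :: "complex^'a^'b"
  assumes "\<And>x. trace (A ** x) = trace (B ** x)"
  shows "A = B"
proof (rule matrix_ext)
  fix i j
  show "A $ i $ j = B $ i $ j"
    using assms [of "matrix_unit j i"] by (simp add: trace_matrix_unit)
qed

lemma matrix_unit_decomp:
  fixes A :: "complex^'a::finite^'b::finite"
  shows "A = (\<Sum>i\<in>UNIV. \<Sum>j\<in>UNIV. cscale (A $ i $ j) (matrix_unit i j))"
proof (rule matrix_ext)
  fix a b
  have "(\<Sum>i\<in>UNIV. \<Sum>j\<in>UNIV. cscale (A $ i $ j) (matrix_unit i j)) $ a $ b =
      (\<Sum>i\<in>UNIV. \<Sum>j\<in>UNIV. if i = a \<and> j = b then A $ i $ j else 0)"
    unfolding sum_component by (intro sum.cong refl) (auto simp: cscale_nth matrix_unit_nth)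
  then show "A $ a $ b = (\<Sum>i\<in>UNIV. \<Sum>j\<in>UNIV. cscale (A $ i $ j) (matrix_unit i j)) $ a $ b"
    by (simp add: sum_delta_conj)
qed

lemma matrix_unit_kron: "matrix_unit (i, k) (j, l) = kron (matrix_unit i j) (matrix_unit k l)"
  by (rule matrix_ext) (auto simp add: kron_nth matrix_unit_nth)

lemma matrix_eq_trace_kron:
  assumes "\<And>x y. trace (A ** kron x y) = trace (B ** kron x y)"
  shows "A = B"
proof (rule matrix_ext)
  fix p q
  show "A $ p $ q = B $ p $ q"
    using assms [of "matrix_unit (fst q) (fst p)" "matrix_unit (snd q) (snd p)"]
    by (simp add: matrix_unit_kron [symmetric] trace_matrix_unit)
qed

lemma central_matrix:
  fixes B :: "complex^'n^'n"
  assumes "\<And>z. z ** B = B ** z"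
  obtains c where "B = cscale c (mat 1)"
proof -
  have l: "(matrix_unit i j ** B) $ a $ b = (if a = i then B $ j $ b else 0)" for i j a b :: 'n
  proof -
    have "(matrix_unit i j ** B) $ a $ b = (\<Sum>k\<in>UNIV. if a = i \<and> k = j then B $ k $ b else 0)"
      unfolding matrix_mult_nth by (intro sum.cong refl) (auto simp: matrix_unit_nth)
    then show ?thesis by (simp add: sum_delta_conj)
  qed
  have r: "(B ** matrix_unit i j) $ a $ b = (if b = j then B $ a $ i else 0)" for i j a b :: 'n
  proof -
    have "(B ** matrix_unit i j) $ a $ b = (\<Sum>k\<in>UNIV. if k = i \<and> b = j then B $ a $ k else 0)"
      unfolding matrix_mult_nth by (intro sum.cong refl) (auto simp: matrix_unit_nth)
    then show ?thesis by (simp add: sum_delta_conj)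
  qed
  have B: "B $ a $ b = B $ undefined $ undefined * (if a = b then 1 else 0)" for a b
  proof -
    have "B $ a $ b = (matrix_unit (undefined :: 'n) a ** B) $ undefined $ b"
      by (simp add: l)
    also have "\<dots> = (B ** matrix_unit (undefined :: 'n) a) $ undefined $ b"
      by (simp only: assms)
    finally show ?thesis by (simp add: r eq_commute [of b])
  qed
  have "B = cscale (B $ undefined $ undefined) (mat 1)"
    unfolding vec_eq_iff cscale_nth mat_1_nth by (intro allI) (rule B)
  then show ?thesis
    by (rule that)
qed

lemma cinner_add_right: "cinner u (v + w) = cinner u v + cinner u w"
  by (simp add: cinner_def algebra_simps sum.distrib)

lemma cinner_diff_right: "cinner u (v - w) = cinner u v - cinner u w"
  by (simp add: cinner_def algebra_simps sum_subtractf)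

lemma cinner_add_left: "cinner (v + w) u = cinner v u + cinner w u"
  by (simp add: cinner_def algebra_simps sum.distrib)

lemma cinner_diff_left: "cinner (v - w) u = cinner v u - cinner w u"
  by (simp add: cinner_def algebra_simps sum_subtractf)

lemma cinner_scale_right: "cinner u (c *s v) = c * cinner u v"
  by (simp add: cinner_def sum_distrib_left algebra_simps)

lemma cinner_scale_left: "cinner (c *s u) v = cnj c * cinner u v"
  by (simp add: cinner_def sum_distrib_left algebra_simps)

lemma cnj_cinner: "cnj (cinner u v) = cinner v u"
  by (simp add: cinner_def mult.commute)

lemma cinner_adj: "cinner u (A *v v) = cinner (adj A *v u) v"
  by (simp add: cinner_def matrix_vector_mult_def adj_nth sum_distrib_left sum_distrib_right mult_ac)
    (rule sum.swap)

lemma cinner_self: "cinner u u = of_real (\<Sum>i\<in>UNIV. (cmod (u $ i))\<^sup>2)"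
  by (simp add: cinner_def complex_norm_square mult.commute del: of_real_power)

lemma cinner_self_nonneg: "cinner u u \<in> \<real>\<^sub>\<ge>\<^sub>0"
  unfolding cinner_self nonneg_Reals_of_real_iff by (simp add: sum_nonneg)

lemma cinner_self_eq_0: "cinner u u = 0 \<longleftrightarrow> u = 0"
  unfolding cinner_self of_real_eq_0_iff
  by (subst sum_nonneg_eq_0_iff) (auto simp: vec_eq_iff)

lemma cinner_axis_left: "cinner (axis i 1) v = v $ i"
  by (simp add: cinner_def axis_def if_distrib [of cnj] if_distrib [of "\<lambda>x. x * _"] cong: if_cong)

lemma matrix_vector_axis: "(A *v axis j 1) $ i = (A :: complex^'a^'b) $ i $ j"
  by (simp add: matrix_vector_mult_def axis_def if_distrib [of "(*) _"] cong: if_cong)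

lemma matrix_vector_scale: "(A :: complex^'a^'b) *v (c *s v) = c *s (A *v v)"
  by (simp add: vec_eq_iff matrix_vector_mult_def sum_distrib_left mult_ac)

lemma cscale_vector: "cscale c A *v v = c *s (A *v v)"
  by (simp add: vec_eq_iff matrix_vector_mult_def cscale_nth sum_distrib_left mult_ac)

lemma matrix_eq_zero: "(\<And>i. A *v axis i 1 = 0) \<Longrightarrow> A = (0 :: complex^'a^'b)"
  by (rule matrix_ext) (metis matrix_vector_axis zero_index)

lemma trace_eq_sum_cinner: "trace A = (\<Sum>i\<in>UNIV. cinner (axis i 1) (A *v axis i 1))"
  by (simp add: trace_def cinner_axis_left matrix_vector_axis)

definition outer :: "complex^'a \<Rightarrow> complex^'b \<Rightarrow> complex^'b^'a" where
  "outer v w = (\<chi> i j. v $ i * cnj (w $ j))"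

lemma outer_nth: "outer v w $ i $ j = v $ i * cnj (w $ j)"
  by (simp add: outer_def)

lemma outer_vector: "outer v w *v u = cinner w u *s v"
  by (simp add: vec_eq_iff matrix_vector_mult_def outer_nth cinner_def sum_distrib_left mult_ac)

lemma trace_outer: "trace (A ** outer v w) = cinner w (A *v v)"
  by (simp add: trace_def matrix_mult_nth outer_nth cinner_def matrix_vector_mult_def
      sum_distrib_left mult_ac)

subsection \<open>Positive operators\<close>

lemma positive_operator_hermitian:
  assumes "positive_operator P"
  shows "adj P = P"
proof (rule matrix_ext)
  fix i j
  have im: "Im (cinner u (P *v u)) = 0" for u
    using assms by (simp add: positive_operator_def complex_nonneg_Reals_iff)
  have ex: "cinner (axis i 1 + c *s axis j 1) (P *v (axis i 1 + c *s axis j 1)) =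
      P $ i $ i + c * P $ i $ j + cnj c * P $ j $ i + cnj c * c * P $ j $ j" for c
    by (simp add: cinner_add_left cinner_add_right cinner_scale_left cinner_scale_right
        matrix_vector_right_distrib matrix_vector_scale cinner_axis_left matrix_vector_axis algebra_simps)
  have "Im (P $ i $ i) = 0" "Im (P $ j $ j) = 0"
    using im [of "axis i 1"] im [of "axis j 1"] by (simp_all add: cinner_axis_left matrix_vector_axis)
  with im [of "axis i 1 + 1 *s axis j 1"] im [of "axis i 1 + \<i> *s axis j 1"]
  show "adj P $ i $ j = P $ i $ j"
    unfolding ex by (auto simp: adj_nth complex_eq_iff)
qed

lemma positive_operator_subtract:
  assumes P: "positive_operator P" and e: "cinner e (P *v e) \<noteq> 0"
  shows "positive_operator (P - cscale (1 / cinner e (P *v e)) (outer (P *v e) (P *v e)))"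
  unfolding positive_operator_def
proof
  fix u
  let ?c = "cinner e (P *v e)"
  let ?a = "cinner e (P *v u)"
  have h: "adj P = P"
    using P by (rule positive_operator_hermitian)
  have ua: "cinner u (P *v e) = cnj ?a" and ua': "cinner (P *v e) u = ?a"
    by (simp_all add: cnj_cinner cinner_adj h)
  have c: "cnj ?c = ?c"
    by (simp add: cnj_cinner cinner_adj h)
  have "cinner u ((P - cscale (1 / ?c) (outer (P *v e) (P *v e))) *v u) =
      cinner u (P *v u) - 1 / ?c * ?a * cnj ?a"
    by (simp add: matrix_vector_mult_diff_rdistrib cscale_vector outer_vector cinner_diff_right
        cinner_scale_right ua ua')
  also have "\<dots> = cinner (u - (?a / ?c) *s e) (P *v (u - (?a / ?c) *s e))"
    using e by (simp add: matrix_vector_mult_diff_distrib matrix_vector_scale cinner_diff_right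
        cinner_diff_left cinner_scale_left cinner_scale_right ua c field_simps)
  also have "\<dots> \<in> \<real>\<^sub>\<ge>\<^sub>0"
    using P by (simp add: positive_operator_def)
  finally show "cinner u ((P - cscale (1 / ?c) (outer (P *v e) (P *v e))) *v u) \<in> \<real>\<^sub>\<ge>\<^sub>0" .
qed

lemma positive_operator_null:
  assumes P: "positive_operator P" and w: "cinner w (P *v w) = 0"
  shows "P *v w = 0"
proof (rule ccontr)
  let ?z = "P *v w"
  assume "?z \<noteq> 0"
  then have n: "Re (cinner ?z ?z) > 0"
    using cinner_self_nonneg [of ?z] cinner_self_eq_0 [of ?z]
    by (auto simp: complex_nonneg_Reals_iff complex_eq_iff less_le)
  have h: "adj P = P"
    using P by (rule positive_operator_hermitian)
  have wz: "cinner w (P *v ?z) = cinner ?z ?z"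
    by (simp add: cinner_adj h)
  let ?K = "Re (cinner ?z (P *v ?z))"
  have K: "?K \<ge> 0"
    using P by (simp add: positive_operator_def complex_nonneg_Reals_iff)
  define s where "s = Re (cinner ?z ?z) / (?K + 1)"
  have s: "s > 0" using n K by (simp add: s_def)
  have "0 \<le> Re (cinner (w - complex_of_real s *s ?z) (P *v (w - complex_of_real s *s ?z)))"
    using P by (simp add: positive_operator_def complex_nonneg_Reals_iff)
  also have "\<dots> = s * (s * ?K) - 2 * s * Re (cinner ?z ?z)"
    by (simp add: matrix_vector_mult_diff_distrib matrix_vector_scale cinner_diff_right
        cinner_diff_left cinner_scale_left cinner_scale_right wz w algebra_simps)
  also have "\<dots> = s * (s * ?K - 2 * Re (cinner ?z ?z))"
    by (simp add: algebra_simps)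
  finally have "2 * Re (cinner ?z ?z) \<le> s * ?K"
    using s by (simp add: zero_le_mult_iff)
  moreover have "s * ?K \<le> s * (?K + 1)" using s by simp
  moreover have "s * (?K + 1) = Re (cinner ?z ?z)" using K by (simp add: s_def)
  ultimately show False using n by simp
qed

lemma sum_nonneg_Reals: "(\<And>i. i \<in> I \<Longrightarrow> f i \<in> \<real>\<^sub>\<ge>\<^sub>0) \<Longrightarrow> sum f I \<in> \<real>\<^sub>\<ge>\<^sub>0"
  for f :: "'a \<Rightarrow> complex"
  by (simp add: complex_nonneg_Reals_iff sum_nonneg)

lemma sum_nonneg_Reals_eq_0:
  fixes f :: "'a::finite \<Rightarrow> complex"
  assumes "\<And>i. f i \<in> \<real>\<^sub>\<ge>\<^sub>0" "sum f UNIV = 0"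
  shows "f i = 0"
proof -
  have "(\<Sum>i\<in>UNIV. Re (f i)) = 0"
    using arg_cong [OF assms(2), of Re] by simp
  then have "Re (f i) = 0"
    using assms(1) by (subst (asm) sum_nonneg_eq_0_iff) (auto simp: complex_nonneg_Reals_iff)
  then show ?thesis
    using assms(1) [of i] by (simp add: complex_nonneg_Reals_iff complex_eq_iff)
qed

lemma trace_positive:
  assumes "positive_operator P"
  shows "trace P \<in> \<real>\<^sub>\<ge>\<^sub>0"
  unfolding trace_eq_sum_cinner using assms by (intro sum_nonneg_Reals) (simp add: positive_operator_def)

lemma trace_positive_eq_0:
  assumes "positive_operator P" "trace P = 0"
  shows "P = 0"
proof (rule matrix_eq_zero)
  fix i
  have "cinner (axis i 1) (P *v axis i 1) = 0"
    using assms unfolding trace_eq_sum_cinner positive_operator_def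
    by (intro sum_nonneg_Reals_eq_0 [of "\<lambda>i. cinner (axis i 1) (P *v axis i 1)"]) simp_all
  with assms show "P *v axis i 1 = 0"
    by (intro positive_operator_null)
qed

lemma positive_operator_congruence:
  assumes "positive_operator P"
  shows "positive_operator (adj A ** P ** A)"
  using assms by (simp add: positive_operator_def cinner_adj [of _ "adj A"] matrix_vector_mul_assoc [symmetric])

lemma positive_operator_mat_1: "positive_operator (mat 1)"
  by (simp add: positive_operator_def cinner_self_nonneg)

lemma positive_operator_adj_mult: "positive_operator (adj A ** A)"
  using positive_operator_congruence [OF positive_operator_mat_1, of A] by simp

lemma positive_operator_cscale:
  "positive_operator P \<Longrightarrow> c \<in> \<real>\<^sub>\<ge>\<^sub>0 \<Longrightarrow> positive_operator (cscale c P)"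
  by (simp add: positive_operator_def cscale_vector cinner_scale_right nonneg_Reals_mult_I)

lemma positive_congruence_null:
  assumes P: "positive_operator P" and z: "trace (adj A ** P ** A) = 0"
  shows "P ** A = 0"
proof (rule matrix_eq_zero)
  fix i
  have 0: "adj A ** P ** A = 0"
    using trace_positive_eq_0 [OF positive_operator_congruence [OF P] z] .
  have "cinner (A *v axis i 1) (P *v (A *v axis i 1)) = cinner (axis i 1) ((adj A ** P ** A) *v axis i 1)"
    by (simp add: cinner_adj [of _ "adj A"] matrix_vector_mul_assoc [symmetric])
  also have "\<dots> = 0"
    by (simp add: 0 cinner_def)
  finally show "(P ** A) *v axis i 1 = 0"
    using positive_operator_null [OF P] by (simp add: matrix_vector_mul_assoc [symmetric])
qed

lemma outer_scale: "outer (c *s v) (c *s v) = cscale (c * cnj c) (outer v v)"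
  by (rule matrix_ext) (simp add: outer_nth cscale_nth)

lemma positive_operator_cholesky:
  fixes P :: "complex^'n^'n"
  assumes P: "positive_operator P"
  obtains A :: "complex^'n^'n" where "P = A ** adj A"
proof -
  have "\<exists>w. positive_operator (P - (\<Sum>k\<in>S. outer (w k) (w k))) \<and>
      (\<forall>k\<in>S. (P - (\<Sum>k\<in>S. outer (w k) (w k))) *v axis k 1 = 0)"
    if "finite S" for S :: "'n set"
    using that
  proof (induction S)
    case empty
    then show ?case using P by simp
  next
    case (insert k S)
    then obtain w where w: "positive_operator (P - (\<Sum>k\<in>S. outer (w k) (w k)))"
      and w0: "\<And>j. j \<in> S \<Longrightarrow> (P - (\<Sum>k\<in>S. outer (w k) (w k))) *v axis j 1 = 0"
      by blast
    define Q where "Q = P - (\<Sum>k\<in>S. outer (w k) (w k))"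
    have Q: "positive_operator Q" and Q0: "\<And>j. j \<in> S \<Longrightarrow> Q *v axis j 1 = 0"
      using w w0 by (simp_all add: Q_def)
    define e :: "complex^'n" where "e = axis k 1"
    define c where "c = cinner e (Q *v e)"
    have c: "c \<in> \<real>\<^sub>\<ge>\<^sub>0"
      using Q by (simp add: c_def positive_operator_def)
    define z where "z = complex_of_real (1 / sqrt (Re c)) *s (Q *v e)"
    have step: "P - (\<Sum>j\<in>insert k S. outer ((w(k := v)) j) ((w(k := v)) j)) = Q - outer v v" for v
    proof -
      have "(\<Sum>j\<in>S. outer ((w(k := v)) j) ((w(k := v)) j)) = (\<Sum>j\<in>S. outer (w j) (w j))"
        using insert.hyps by (intro sum.cong) auto
      then show ?thesis
        using insert.hyps by (simp add: Q_def)
    qed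
    have "\<exists>v. positive_operator (Q - outer v v) \<and> (\<forall>j\<in>insert k S. (Q - outer v v) *v axis j 1 = 0)"
    proof (cases "c = 0")
      case True
      then have "Q *v e = 0"
        using positive_operator_null [OF Q] by (simp add: c_def)
      moreover have "outer 0 0 = (0 :: complex^'n^'n)"
        by (rule matrix_ext) (simp add: outer_nth)
      ultimately show ?thesis
        using Q Q0 by (intro exI [of _ 0]) (auto simp: e_def)
    next
      case False
      with c have re: "Re c > 0" and ofc: "complex_of_real (Re c) = c"
        by (auto simp: complex_nonneg_Reals_iff complex_eq_iff)
      have "complex_of_real (1 / sqrt (Re c)) * cnj (complex_of_real (1 / sqrt (Re c))) = 1 / c"
        using re by (simp add: ofc flip: of_real_mult)
      then have z: "outer z z = cscale (1 / c) (outer (Q *v e) (Q *v e))"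
        unfolding z_def outer_scale by simp
      have "positive_operator (Q - outer z z)"
        unfolding z c_def using Q False by (intro positive_operator_subtract) (simp_all add: c_def)
      moreover have "(Q - outer z z) *v axis j 1 = 0" if "j \<in> insert k S" for j
      proof -
        have "cinner (Q *v e) (axis j 1) = cinner e (Q *v axis j 1)"
          by (simp add: cinner_adj positive_operator_hermitian [OF Q])
        then have "(Q - outer z z) *v axis j 1 =
            Q *v axis j 1 - (1 / c * cinner e (Q *v axis j 1)) *s (Q *v e)"
          unfolding z by (simp add: matrix_vector_mult_diff_rdistrib cscale_vector outer_vector)
        then show ?thesis
          using that Q0 False by (cases "j = k") (auto simp: c_def e_def cinner_def)
      qed
      ultimately show ?thesis by blast
    qed
    then obtain v where "positive_operator (Q - outer v v)"
      "\<forall>j\<in>insert k S. (Q - outer v v) *v axis j 1 = 0"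
      by blast
    then show ?case
      by (intro exI [of _ "w(k := v)"]) (simp only: step simp_thms)
  qed
  from this [of UNIV] obtain w :: "'n \<Rightarrow> complex^'n" where
    w: "\<And>k. (P - (\<Sum>k\<in>UNIV. outer (w k) (w k))) *v axis k 1 = 0"
    by auto
  have "P - (\<Sum>k\<in>UNIV. outer (w k) (w k)) = 0"
    by (rule matrix_eq_zero) (rule w)
  then have "P = (\<Sum>k\<in>UNIV. outer (w k) (w k))"
    by simp
  also have "\<dots> = (\<chi> i k. w k $ i) ** adj (\<chi> i k. w k $ i)"
    by (rule matrix_ext) (simp add: matrix_mult_nth adj_nth outer_nth)
  finally show ?thesis
    by (rule that)
qed

lemma compact_unitary: "compact {U :: complex^'n^'n. adj U ** U = mat 1}"
proof -
  have eq: "{U :: complex^'n^'n. adj U ** U = mat 1} =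
      {U. \<forall>i j. (\<Sum>k\<in>UNIV. cnj (U $ k $ i) * U $ k $ j) = (mat 1 :: complex^'n^'n) $ i $ j}"
    by (simp add: vec_eq_iff matrix_mult_nth adj_nth)
  have "closed {U :: complex^'n^'n. adj U ** U = mat 1}"
    unfolding eq by (intro closed_Collect_all closed_Collect_eq continuous_intros)
  moreover have "bounded {U :: complex^'n^'n. adj U ** U = mat 1}"
  proof (rule boundedI)
    fix U :: "complex^'n^'n"
    assume U: "U \<in> {U. adj U ** U = mat 1}"
    have "cmod (U $ i $ j) \<le> 1" for i j
    proof -
      have "complex_of_real (\<Sum>k\<in>UNIV. (cmod (U $ k $ j))\<^sup>2) = (adj U ** U) $ j $ j"
        by (simp add: matrix_mult_nth adj_nth complex_norm_square mult.commute del: of_real_power)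
      then have "(\<Sum>k\<in>UNIV. (cmod (U $ k $ j))\<^sup>2) = 1"
        using U by (simp add: mat_1_nth del: of_real_power of_real_sum)
      moreover have "(cmod (U $ i $ j))\<^sup>2 \<le> (\<Sum>k\<in>UNIV. (cmod (U $ k $ j))\<^sup>2)"
        by (rule member_le_sum) auto
      ultimately show ?thesis
        by (simp add: power_le_one_iff)
    qed
    then have "norm (U $ i) \<le> (\<Sum>j\<in>(UNIV::'n set). 1)" for i
      unfolding norm_vec_def by (intro order_trans [OF L2_set_le_sum] sum_mono) auto
    then show "norm U \<le> (\<Sum>i\<in>(UNIV::'n set). \<Sum>j\<in>(UNIV::'n set). 1)"
      unfolding norm_vec_def [of U] by (intro order_trans [OF L2_set_le_sum] sum_mono) auto
  qed
  ultimately show ?thesis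
    by (simp add: compact_eq_bounded_closed)
qed

text \<open>Polar decomposition by maximisation: multiplying a maximiser on the left by the rotation of
  a single vector shows that the product is a positive operator.\<close>

lemma polar_decomposition:
  fixes B :: "complex^'n^'n"
  obtains U where "adj U ** U = mat 1" "positive_operator (U ** B)"
proof -
  let ?K = "{U :: complex^'n^'n. adj U ** U = mat 1}"
  have "continuous_on ?K (\<lambda>U. Re (trace (U ** B)))"
    unfolding trace_def matrix_mult_nth by (intro continuous_intros)
  moreover have "mat 1 \<in> ?K" by simp
  ultimately have "\<exists>U\<in>?K. \<forall>V\<in>?K. Re (trace (V ** B)) \<le> Re (trace (U ** B))"
    by (intro continuous_attains_sup compact_unitary) blast+
  then obtain U where U: "U \<in> ?K" and max: "\<And>V. V \<in> ?K \<Longrightarrow> Re (trace (V ** B)) \<le> Re (trace (U ** B))"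
    by blast
  have "cinner u ((U ** B) *v u) \<in> \<real>\<^sub>\<ge>\<^sub>0" for u
  proof (cases "u = 0")
    case True
    then show ?thesis by (simp add: cinner_def)
  next
    case False
    define N where "N = cinner u u"
    have N: "N \<noteq> 0" "N \<in> \<real>\<^sub>\<ge>\<^sub>0" "cnj N = N"
      using False by (simp_all add: N_def cinner_self_eq_0 cinner_self_nonneg cnj_cinner)
    define z where "z = cinner u ((U ** B) *v u) / N"
    define E where "E = outer u u"
    have EE: "E ** E = cscale N E" and aE: "adj E = E"
      by (rule matrix_ext,
          simp add: E_def N_def matrix_mult_nth outer_nth cscale_nth adj_nth cinner_def
            sum_distrib_right sum_distrib_left mult_ac)+
    have le: "Re ((\<omega> - 1) * z) \<le> 0" if \<omega>: "cnj \<omega> * \<omega> = 1" for \<omega>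
    proof -
      define W where "W = mat 1 + cscale ((\<omega> - 1) / N) E"
      have "adj W ** W = mat 1 + cscale ((\<omega> - 1) / N) E + cscale ((cnj \<omega> - 1) / N) E
          + cscale ((cnj \<omega> - 1) / N * ((\<omega> - 1) / N) * N) E"
        by (simp add: W_def adj_add adj_cscale aE N matrix_plus_ldistrib matrix_plus_rdistrib
            cscale_mult_left cscale_mult_right EE cscale_add mult_ac)
      also have "\<dots> = mat 1 + cscale ((cnj \<omega> * \<omega> - 1) / N) E"
        using N by (intro matrix_ext) (simp add: cscale_nth field_simps)
      also have "\<dots> = mat 1"
        by (intro matrix_ext) (simp add: cscale_nth \<omega>)
      finally have WW: "adj W ** W = mat 1" .
      have "adj (W ** U) ** (W ** U) = adj U ** (adj W ** W) ** U"
        by (simp add: adj_mult matrix_mul_assoc)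
      then have "W ** U \<in> ?K"
        using U WW by simp
      then have "Re (trace (W ** U ** B)) \<le> Re (trace (U ** B))"
        by (rule max)
      also have "trace (W ** U ** B) = trace (U ** B) + (\<omega> - 1) / N * trace (E ** (U ** B))"
        by (simp add: W_def matrix_plus_rdistrib cscale_mult_left trace_add trace_cscale matrix_mul_assoc)
      also have "trace (E ** (U ** B)) = N * z"
        using N by (subst trace_mul_sym) (simp add: E_def trace_outer z_def)
      finally show ?thesis using N by simp
    qed
    have "z \<in> \<real>\<^sub>\<ge>\<^sub>0"
    proof (cases "z = 0")
      case False
      define \<omega> where "\<omega> = cnj z / of_real (cmod z)"
      have "cnj \<omega> * \<omega> = 1" and \<omega>z: "\<omega> * z = of_real (cmod z)"
        using False complex_norm_square [of z] by (simp_all add: \<omega>_def field_simps power2_eq_square)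
      then have "cmod z \<le> Re z"
        using le [of \<omega>] by (simp add: left_diff_distrib)
      then have "Re z = cmod z"
        using complex_Re_le_cmod [of z] by simp
      then show ?thesis
        using cmod_power2 [of z] by (simp add: complex_nonneg_Reals_iff)
    qed simp
    moreover have "cinner u ((U ** B) *v u) = N * z"
      using N by (simp add: z_def)
    ultimately show ?thesis
      using N nonneg_Reals_mult_I by simp
  qed
  then show ?thesis
    using U by (intro that) (auto simp: positive_operator_def)
qed

lemma positive_operator_sqrt:
  fixes P :: "complex^'n^'n"
  assumes "positive_operator P"
  obtains r where "positive_operator r" "r ** r = P"
proof -
  obtain A :: "complex^'n^'n" where A: "P = A ** adj A"
    by (rule positive_operator_cholesky [OF assms])
  obtain U where U: "adj U ** U = mat 1" "positive_operator (U ** adj A)"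
    by (rule polar_decomposition)
  have "(U ** adj A) ** (U ** adj A) = adj (U ** adj A) ** (U ** adj A)"
    by (simp add: positive_operator_hermitian U)
  also have "\<dots> = A ** (adj U ** U) ** adj A"
    by (simp add: adj_mult matrix_mul_assoc)
  finally show ?thesis
    using U A by (intro that) simp_all
qed

lemma positive_sqrt_unique:
  fixes P Q :: "complex^'n^'n"
  assumes P: "positive_operator P" and Q: "positive_operator Q" and PQ: "P ** P = Q ** Q"
    and inv: "R ** P = mat 1"
  shows "P = Q"
proof -
  define X where "X = P - Q"
  have aX: "adj X = X"
    by (simp add: X_def adj_diff positive_operator_hermitian P Q)
  have "X ** P + Q ** X = 0"
    by (simp add: X_def matrix_diff_ldistrib matrix_diff_rdistrib PQ)
  then have "(X ** P + Q ** X) ** X = 0" by simp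
  then have "trace (X ** P ** X) + trace (Q ** X ** X) = 0"
    by (simp add: matrix_plus_rdistrib trace_add [symmetric]) (simp add: trace_def)
  also have "trace (Q ** X ** X) = trace (X ** Q ** X)"
    by (subst trace_mul_sym) (simp add: matrix_mul_assoc)
  finally have "trace (adj X ** P ** X) + trace (adj X ** Q ** X) = 0"
    by (simp add: aX)
  moreover have "trace (adj X ** P ** X) \<in> \<real>\<^sub>\<ge>\<^sub>0" "trace (adj X ** Q ** X) \<in> \<real>\<^sub>\<ge>\<^sub>0"
    by (intro trace_positive positive_operator_congruence P Q)+
  ultimately have "trace (adj X ** P ** X) = 0"
    by (auto simp: complex_nonneg_Reals_iff complex_eq_iff)
  then have "P ** X = 0"
    by (rule positive_congruence_null [OF P])
  then have "(R ** P) ** X = 0"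
    by (simp add: matrix_mul_assoc [symmetric])
  then show ?thesis
    by (simp add: inv X_def)
qed

subsection \<open>States and density matrices\<close>

lemma state_cscale: "is_state \<psi> \<Longrightarrow> blinfun_apply \<psi> (cscale c a) = c * blinfun_apply \<psi> a"
  by (simp add: is_state_def)

lemma adj_outer_mult:
  "adj (outer (axis k 1) u) ** outer (axis k 1) u = outer u (u :: complex^'k)"
  by (rule matrix_ext)
    (simp add: matrix_mult_nth adj_nth outer_nth axis_def if_distrib [of cnj] if_distrib [of "\<lambda>x. x * _"]
      if_distrib [of "\<lambda>x. _ * x"] cong: if_cong)

lemma state_density:
  fixes \<psi> :: "(complex^'k^'k) \<Rightarrow>\<^sub>L complex"
  assumes "is_state \<psi>"
  obtains D where "positive_operator D" "trace D = 1" "\<And>a. blinfun_apply \<psi> a = trace (D ** a)"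
proof -
  define D :: "complex^'k^'k" where "D = (\<chi> q p. blinfun_apply \<psi> (matrix_unit p q))"
  have D: "blinfun_apply \<psi> a = trace (D ** a)" for a
  proof -
    have "blinfun_apply \<psi> a =
        (\<Sum>i\<in>UNIV. \<Sum>j\<in>UNIV. a $ i $ j * blinfun_apply \<psi> (matrix_unit i j))"
      using arg_cong [OF matrix_unit_decomp [of a], of "blinfun_apply \<psi>"]
      by (simp only: blinfun.sum_right state_cscale [OF assms])
    also have "\<dots> = trace (a ** D)"
      by (simp add: trace_def matrix_mult_nth D_def)
    finally show ?thesis
      by (simp only: trace_mul_sym [of a D])
  qed
  have "cinner u (D *v u) \<in> \<real>\<^sub>\<ge>\<^sub>0" for u
  proof -
    have "blinfun_apply \<psi> (adj a ** a) \<in> \<real>\<^sub>\<ge>\<^sub>0" for a :: "complex^'k^'k"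
      using assms by (simp add: is_state_def)
    from this [of "outer (axis undefined 1) u"] show ?thesis
      unfolding adj_outer_mult D trace_outer .
  qed
  then have "positive_operator D"
    by (simp add: positive_operator_def)
  moreover have "trace D = 1"
    using assms D [of "mat 1"] by (simp add: is_state_def)
  ultimately show ?thesis
    using D by (rule that)
qed

lemma density_state:
  fixes D :: "complex^'k^'k"
  assumes "positive_operator D" "trace D = 1"
  shows "\<exists>\<psi>. is_state \<psi> \<and> (\<forall>a. blinfun_apply \<psi> a = trace (D ** a))"
proof -
  have "linear (\<lambda>a. trace (D ** a))"
    by (rule linearI) (simp_all add: matrix_plus_ldistrib trace_add scaleR_eq_cscale
        cscale_mult_right trace_cscale scaleR_conv_of_real)
  then have app: "blinfun_apply (Blinfun (\<lambda>a. trace (D ** a))) a = trace (D ** a)" for a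
    by (simp add: bounded_linear_Blinfun_apply linear_conv_bounded_linear)
  have "trace (D ** (adj a ** a)) = trace (adj (adj a) ** D ** adj a)" for a :: "complex^'k^'k"
    using trace_mul_sym [of "D ** adj a" a] by (simp add: matrix_mul_assoc)
  then have "trace (D ** (adj a ** a)) \<in> \<real>\<^sub>\<ge>\<^sub>0" for a :: "complex^'k^'k"
    using trace_positive [OF positive_operator_congruence [OF assms(1), of "adj a"]] by simp
  then have "is_state (Blinfun (\<lambda>a. trace (D ** a)))"
    by (simp add: is_state_def app cscale_mult_right trace_cscale assms)
  then show ?thesis
    using app by blast
qed

text \<open>Subtracting from the density matrix the rank one part through a vector that it does not
  annihilate leaves a positive matrix.\<close>

lemma pure_state_vector:
  fixes \<psi> :: "(complex^'k^'k) \<Rightarrow>\<^sub>L complex"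
  assumes "pure_state \<psi>"
  obtains w where "\<And>a. blinfun_apply \<psi> a = cinner w (a *v w)"
proof -
  have st: "is_state \<psi>" and ext: "\<And>\<alpha> \<beta>. is_state \<alpha> \<Longrightarrow> is_state \<beta> \<Longrightarrow> \<psi> \<notin> open_segment \<alpha> \<beta>"
    using assms by (auto simp: pure_state_def extreme_point_of_def)
  obtain D where D: "positive_operator D" "trace D = 1" and \<psi>: "\<And>a. blinfun_apply \<psi> a = trace (D ** a)"
    using state_density [OF st] by blast
  have "D \<noteq> 0"
    using D by (auto simp: trace_def)
  then obtain e where e: "D *v e \<noteq> 0"
    using matrix_eq_zero [of D] by blast
  define v where "v = D *v e"
  define c where "c = cinner e v"
  have c: "c \<noteq> 0" "c \<in> \<real>\<^sub>\<ge>\<^sub>0"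
    using positive_operator_null [OF D(1), of e] e D by (auto simp: c_def v_def positive_operator_def)
  define E where "E = cscale (1 / c) (outer v v)"
  have pE: "positive_operator E"
    unfolding E_def
  proof (rule positive_operator_cscale)
    show "positive_operator (outer v v)"
      using positive_operator_adj_mult adj_outer_mult by metis
    show "1 / c \<in> \<real>\<^sub>\<ge>\<^sub>0"
      using c by (simp add: nonneg_Reals_divide_I)
  qed
  have pF: "positive_operator (D - E)"
    using positive_operator_subtract [OF D(1), of e] c by (simp add: E_def c_def v_def)
  define t where "t = Re (trace E)"
  have t: "trace E = of_real t" "t \<ge> 0"
    using trace_positive [OF pE] by (auto simp: t_def complex_nonneg_Reals_iff complex_eq_iff)
  have t0: "t \<noteq> 0"
  proof
    assume "t = 0"
    then have "E = 0"
      using trace_positive_eq_0 [OF pE] t by simp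
    then have "cscale c E = 0"
      by (simp add: vec_eq_iff cscale_nth)
    then have "outer v v = 0"
      using c by (simp add: E_def)
    then have "v $ i = 0" for i
      using outer_nth [of v v i i] by simp
    then show False
      using e by (simp add: v_def vec_eq_iff)
  qed
  have "trace (D - E) = of_real (1 - t)"
    by (simp add: trace_sub D t)
  with trace_positive [OF pF] have t1: "t \<le> 1"
    by (simp add: complex_nonneg_Reals_iff)
  have DE: "D = cscale (1 / of_real t) E"
  proof (cases "t = 1")
    case True
    then have "D - E = 0"
      by (intro trace_positive_eq_0 [OF pF]) (simp add: trace_sub D t)
    then show ?thesis using True by simp
  next
    case False
    have "positive_operator (cscale (of_real (1 / t)) E)"
      using t by (intro positive_operator_cscale pE) (simp del: of_real_divide)
    moreover have "trace (cscale (of_real (1 / t)) E) = 1"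
      using t t0 by (simp add: trace_cscale)
    ultimately obtain \<alpha> where \<alpha>: "is_state \<alpha>"
      "\<And>a. blinfun_apply \<alpha> a = trace (cscale (1 / of_real t) E ** a)"
      using density_state by fastforce
    have "positive_operator (cscale (of_real (1 / (1 - t))) (D - E))"
      using t1 by (intro positive_operator_cscale pF) (simp del: of_real_divide)
    moreover have "trace (cscale (of_real (1 / (1 - t))) (D - E)) = 1"
      using False by (simp add: trace_cscale trace_sub D t field_simps)
    ultimately obtain \<beta> where \<beta>: "is_state \<beta>"
      "\<And>a. blinfun_apply \<beta> a = trace (cscale (1 / (1 - of_real t)) (D - E) ** a)"
      using density_state by fastforce
    have "\<psi> = (1 - t) *\<^sub>R \<beta> + t *\<^sub>R \<alpha>"
      using t0 False
      by (intro blinfun_eqI)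
        (simp add: \<psi> \<alpha> \<beta> blinfun.add_left blinfun.scaleR_left cscale_mult_left trace_cscale
          scaleR_conv_of_real matrix_diff_rdistrib trace_sub)
    moreover have "0 < t" "t < 1"
      using t t0 t1 False by auto
    ultimately have "\<beta> = \<alpha>"
      using ext [OF \<beta>(1) \<alpha>(1)] unfolding in_segment by blast
    with \<open>\<psi> = _\<close> have "\<psi> = \<alpha>"
      by (simp only: scaleR_left_distrib [symmetric]) simp
    then show ?thesis
      using \<psi> \<alpha> by (intro matrix_eq_trace) metis
  qed
  have "1 / (of_real t * c) \<in> \<real>\<^sub>\<ge>\<^sub>0"
    using c t by (intro nonneg_Reals_divide_I nonneg_Reals_mult_I) simp_all
  then obtain q where q: "q \<ge> 0" "1 / (of_real t * c) = complex_of_real q"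
    by (auto simp: nonneg_Reals_def)
  define s where "s = complex_of_real (sqrt q)"
  have "s * cnj s = 1 / (of_real t * c)"
    unfolding q s_def complex_cnj_complex_of_real of_real_mult [symmetric] using q(1) by simp
  then have "D = outer (s *s v) (s *s v)"
    unfolding DE E_def outer_scale by simp
  then have "blinfun_apply \<psi> a = cinner (s *s v) (a *v (s *s v))" for a
    unfolding \<psi> trace_outer [symmetric] by (simp only: trace_mul_sym [of _ a])
  then show ?thesis
    by (rule that)
qed

subsection \<open>The Tomita conjugation and the coupling map\<close>

lemma faithful_state_sqrt_density:
  fixes \<phi> :: "(complex^'n^'n) \<Rightarrow>\<^sub>L complex"
  assumes "faithful_state \<phi>"
  obtains r s where "positive_operator r" "s ** r = mat 1" "r ** s = mat 1" "adj s = s"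
    "\<And>a. blinfun_apply \<phi> a = trace (r ** r ** a)"
proof -
  have st: "is_state \<phi>" and faith: "\<And>a :: complex^'n^'n. blinfun_apply \<phi> (adj a ** a) = 0 \<Longrightarrow> a = 0"
    using assms by (auto simp: faithful_state_def)
  obtain D where D: "positive_operator D" and \<phi>: "\<And>a. blinfun_apply \<phi> a = trace (D ** a)"
    using state_density [OF st] by blast
  obtain r where r: "positive_operator r" "r ** r = D"
    using positive_operator_sqrt [OF D] by blast
  have "v = 0" if "r *v v = 0" for v
  proof -
    have "D *v v = 0"
      using that by (simp add: r(2) [symmetric] matrix_vector_mul_assoc [symmetric])
    then have "blinfun_apply \<phi> (outer v v) = 0"
      by (simp add: \<phi> trace_outer cinner_def)
    then have "blinfun_apply \<phi> (adj (outer (axis undefined 1) v) ** outer (axis undefined 1) v) = 0"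
      by (simp only: adj_outer_mult)
    then have "outer (axis undefined 1) v = (0 :: complex^'n^'n)"
      by (rule faith)
    then have "v $ i = 0" for i
      using outer_nth [of "axis undefined 1 :: complex^'n" v undefined i] by (simp add: axis_def)
    then show ?thesis
      by (simp add: vec_eq_iff)
  qed
  then obtain s where s: "s ** r = mat 1"
    using matrix_left_invertible_ker [of r] by blast
  then have s': "r ** s = mat 1"
    by (simp add: matrix_left_right_inverse)
  have "adj s ** r = mat 1"
    using arg_cong [OF s', of adj] by (simp add: adj_mult positive_operator_hermitian [OF r(1)])
  then have "adj s ** (r ** s) = s"
    by (simp add: matrix_mul_assoc)
  then have "adj s = s"
    by (simp add: s')
  with r s s' \<phi> show ?thesis
    by (intro that) auto
qed

lemma cinner_eqI: "(\<And>v. cinner v a = cinner v b) \<Longrightarrow> a = b"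
  by (metis cinner_axis_left vec_eq_iff)

lemma closure_range_linear:
  fixes f :: "'a::real_vector \<Rightarrow> 'b::euclidean_space"
  assumes "linear f"
  shows "closure (range f) = range f"
  using assms by (intro closure_closed closed_subspace linear_subspace_image subspace_UNIV)

text \<open>In terms of the square root \<open>r\<close> of the density matrix, with inverse \<open>s\<close>, the modular operator
  satisfies \<open>\<Delta>\<^bsup>1/2\<^esup> x\<Omega> = r x s \<Omega>\<close>, since the right hand side defines another positive square root.\<close>

lemma tomita_conjugation_eq:
  fixes \<phi> :: "(complex^'n^'n) \<Rightarrow>\<^sub>L complex"
    and \<pi> :: "complex^'n^'n \<Rightarrow> complex^'h^'h"
  assumes sf: "standard_form \<phi> \<pi> \<Omega>" and tc: "tomita_conjugation \<pi> \<Omega> J"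
    and r: "positive_operator r" and sr: "s ** r = mat 1" and rs: "r ** s = mat 1"
    and as: "adj s = s" and \<phi>: "\<And>a. blinfun_apply \<phi> a = trace (r ** r ** a)"
  shows "J (\<pi> x *v \<Omega>) = \<pi> (r ** adj x ** s) *v \<Omega>"
    and "cinner (\<pi> x *v \<Omega>) (\<pi> y *v \<Omega>) = trace (r ** r ** adj x ** y)"
proof -
  define T where "T x = \<pi> x *v \<Omega>" for x
  have hom: "unital_star_hom \<pi>" and dense: "closure (range T) = UNIV"
    and sep: "\<And>x. T x = 0 \<Longrightarrow> x = 0" and vec: "\<And>x. blinfun_apply \<phi> x = cinner \<Omega> (T x)"
    using sf by (auto simp: standard_form_def T_def)
  have T_add: "T (x + y) = T x + T y" and T_cscale: "T (cscale c x) = c *s T x" for x y c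
    using hom by (simp_all add: unital_star_hom_def T_def matrix_vector_mult_add_rdistrib cscale_vector)
  have T_scaleR: "T (c *\<^sub>R x) = c *\<^sub>R T x" for c x
    unfolding scaleR_eq_cscale T_cscale scaleR_eq_smult ..
  have linT: "linear T"
    by (rule linearI) (simp_all add: T_add T_scaleR)
  have surj: "surj T"
    using dense closure_range_linear [OF linT] by simp
  have inj: "inj T"
    using sep linear_injective_0 [OF linT] by blast
  have inner: "cinner (T x) (T y) = trace (r ** r ** adj x ** y)" for x y
  proof -
    have "\<pi> (adj x ** y) = adj (\<pi> x) ** \<pi> y"
      using hom by (simp add: unital_star_hom_def)
    then have "cinner (T x) (T y) = cinner \<Omega> (T (adj x ** y))"
      by (simp add: T_def matrix_vector_mul_assoc [symmetric] cinner_adj)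
    then show ?thesis
      by (simp add: vec [symmetric] \<phi> matrix_mul_assoc)
  qed
  then show "cinner (\<pi> x *v \<Omega>) (\<pi> y *v \<Omega>) = trace (r ** r ** adj x ** y)"
    by (simp add: T_def)
  have ar: "adj r = r"
    by (rule positive_operator_hermitian [OF r])
  have sr': "A ** s ** r = A" and rs': "A ** r ** s = A" for A :: "complex^'n^'n"
    by (simp_all add: sr rs flip: matrix_mul_assoc)

  obtain P where au: "antiunitary J" and P: "positive_operator P"
    and graph: "closure (range (\<lambda>x. (T x, T (adj x)))) = range (\<lambda>u. (u, J (P *v u)))"
    using tc by (auto simp: tomita_conjugation_def T_def)
  have "linear (\<lambda>x. (T x, T (adj x)))"
    by (rule linearI) (simp_all add: T_add T_scaleR adj_add adj_scaleR)
  then have graph': "range (\<lambda>x. (T x, T (adj x))) = range (\<lambda>u. (u, J (P *v u)))"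
    using graph by (simp only: closure_range_linear)
  have JP: "J (P *v T x) = T (adj x)" for x
  proof -
    have "(T x, T (adj x)) \<in> range (\<lambda>u. (u, J (P *v u)))"
      unfolding graph' [symmetric] by (rule rangeI)
    then show ?thesis by auto
  qed

  define Q where "Q = matrix (\<lambda>u. T (r ** inv T u ** s))"
  have invT: "inv T (T x) = x" for x
    using inj by simp
  have "Vector_Spaces.linear (*s) (*s) (\<lambda>u. T (r ** inv T u ** s))"
  proof
    fix u v :: "complex^'h" and c
    obtain x y where uv: "u = T x" "v = T y"
      using surj by (metis surjD)
    show "T (r ** inv T (u + v) ** s) = T (r ** inv T u ** s) + T (r ** inv T v ** s)"
      unfolding uv T_add [symmetric] invT by (simp add: matrix_plus_ldistrib matrix_plus_rdistrib)
    show "T (r ** inv T (c *s u) ** s) = c *s T (r ** inv T u ** s)"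
      unfolding uv T_cscale [symmetric] invT by (simp add: cscale_mult_left cscale_mult_right)
  qed
  then have Q: "Q *v T x = T (r ** x ** s)" for x
    using matrix_works by (simp add: Q_def invT)
  have pQ: "positive_operator Q"
    unfolding positive_operator_def
  proof
    fix u
    obtain x where u: "u = T x"
      using surj by (metis surjD)
    obtain A :: "complex^'n^'n" where A: "r = A ** adj A"
      using positive_operator_cholesky [OF r] by blast
    define C where "C = adj A ** x ** A"
    have "cinner u (Q *v u) = trace ((r ** r ** adj x ** r ** x) ** s)"
      unfolding u Q inner by (simp add: matrix_mul_assoc)
    also have "\<dots> = trace (s ** r ** r ** adj x ** r ** x)"
      by (subst trace_mul_sym) (simp add: matrix_mul_assoc)
    also have "\<dots> = trace (A ** (adj A ** adj x ** A ** adj A ** x))"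
      by (simp add: sr) (simp add: A matrix_mul_assoc)
    also have "\<dots> = trace (adj C ** C)"
      by (subst trace_mul_sym) (simp add: C_def adj_mult matrix_mul_assoc)
    finally show "cinner u (Q *v u) \<in> \<real>\<^sub>\<ge>\<^sub>0"
      by (simp add: trace_positive positive_operator_adj_mult)
  qed
  have QP: "Q ** Q = P ** P"
  proof (subst matrix_eq, intro allI cinner_eqI)
    fix u v
    obtain x y where uv: "u = T x" "v = T y"
      using surj by (metis surjD)
    have "cinner v ((Q ** Q) *v u) = trace ((r ** r ** adj y ** r ** r ** x) ** (s ** s))"
      unfolding uv matrix_vector_mul_assoc [symmetric] Q inner by (simp add: matrix_mul_assoc)
    also have "\<dots> = trace (adj y ** (r ** r ** x))"
      by (subst trace_mul_sym) (simp add: matrix_mul_assoc sr' sr)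
    also have "\<dots> = cinner (T (adj x)) (T (adj y))"
      unfolding inner by (subst trace_mul_sym) (simp add: matrix_mul_assoc)
    also have "\<dots> = cinner (P *v v) (P *v u)"
      unfolding JP [symmetric] uv using au unfolding antiunitary_def by blast
    also have "\<dots> = cinner v ((P ** P) *v u)"
      by (simp add: cinner_adj matrix_vector_mul_assoc [symmetric] positive_operator_hermitian [OF P])
    finally show "cinner v ((Q ** Q) *v u) = cinner v ((P ** P) *v u)" .
  qed
  have "u = 0" if "Q *v u = 0" for u
  proof -
    obtain x where u: "u = T x"
      using surj by (metis surjD)
    then have "r ** x ** s = 0"
      using that by (intro sep) (simp add: Q)
    then have "s ** (r ** x ** s) ** r = 0"
      by simp
    then have "x = 0"
      by (simp add: matrix_mul_assoc sr sr')
    then show ?thesis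
      using linear_0 [OF linT] by (simp add: u)
  qed
  then obtain R where "R ** Q = mat 1"
    using matrix_left_invertible_ker [of Q] by blast
  with QP have "Q = P"
    by (intro positive_sqrt_unique [OF pQ P])
  then have "J (T (r ** (s ** x ** r) ** s)) = T (adj (s ** x ** r))"
    unfolding Q [symmetric] by (simp only: JP)
  then show "J (\<pi> x *v \<Omega>) = \<pi> (r ** adj x ** s) *v \<Omega>"
    by (simp add: T_def adj_mult as ar matrix_mul_assoc rs' rs)
qed

lemma state_kron_functional:
  assumes "is_state \<psi>"
  shows "\<exists>E. \<forall>x. blinfun_apply \<psi> (kron x y) = trace (E ** x)"
proof -
  have "blinfun_apply \<psi> (kron x y) = trace ((\<chi> j i. blinfun_apply \<psi> (kron (matrix_unit i j) y)) ** x)" for x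
  proof -
    have *: "linear (\<lambda>x. blinfun_apply \<psi> (kron x y))"
      by (rule linearI) (simp_all add: kron_add_left blinfun.add_right scaleR_eq_cscale
          kron_cscale_left state_cscale [OF assms] scaleR_conv_of_real)
    have "blinfun_apply \<psi> (kron x y) =
        (\<Sum>i\<in>UNIV. \<Sum>j\<in>UNIV. x $ i $ j * blinfun_apply \<psi> (kron (matrix_unit i j) y))"
      using arg_cong [OF matrix_unit_decomp [of x], of "\<lambda>x. blinfun_apply \<psi> (kron x y)"]
      by (simp only: linear_sum [OF *] kron_cscale_left state_cscale [OF assms])
    also have "\<dots> = trace (x ** (\<chi> j i. blinfun_apply \<psi> (kron (matrix_unit i j) y)))"
      by (simp add: trace_def matrix_mult_nth)
    finally show ?thesis
      by (simp only: trace_mul_sym [of x])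
  qed
  then show ?thesis by blast
qed

lemma trace_sandwich_cancel:
  fixes r :: "complex^'n^'n"
  assumes "s ** r = mat 1" "r ** s = mat 1"
    and eq: "\<And>x. trace (r ** x ** r ** t) = trace (r ** x ** r ** t')"
  shows "t = t'"
proof -
  have *: "trace (r ** t ** r ** x) = trace (r ** x ** r ** t)" for t x
    using trace_mul_sym [of "r ** t" "r ** x"] by (simp add: matrix_mul_assoc)
  have "r ** t ** r = r ** t' ** r"
    using eq by (intro matrix_eq_trace) (simp only: *)
  then have "s ** (r ** t ** r) ** s = s ** (r ** t' ** r) ** s"
    by simp
  then show ?thesis
    using assms by (simp add: matrix_mul_assoc) (simp add: assms flip: matrix_mul_assoc)
qed

lemma coupling_map_eq:
  fixes \<phi> :: "(complex^'n^'n) \<Rightarrow>\<^sub>L complex"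
    and \<pi> :: "complex^'n^'n \<Rightarrow> complex^'h^'h"
  assumes sf: "standard_form \<phi> \<pi> \<Omega>" and tc: "tomita_conjugation \<pi> \<Omega> J"
    and r: "positive_operator r" and sr: "s ** r = mat 1" and rs: "r ** s = mat 1"
    and as: "adj s = s" and \<phi>: "\<And>a. blinfun_apply \<phi> a = trace (r ** r ** a)"
    and st: "is_state \<psi>"
  shows "blinfun_apply \<psi> (kron x y) = trace (r ** x ** r ** coupling_map \<pi> \<Omega> J \<psi> y)"
proof -
  have ar: "adj r = r"
    by (rule positive_operator_hermitian [OF r])
  have rs': "A ** r ** s = A" for A :: "complex^'n^'n"
    by (simp add: rs flip: matrix_mul_assoc)
  note J = tomita_conjugation_eq [OF sf tc r sr rs as \<phi>]
  have "\<pi> (mat 1) = mat 1"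
    using sf by (simp add: standard_form_def unital_star_hom_def)
  then have "J \<Omega> = \<Omega>"
    using J(1) [of "mat 1"] by (simp add: rs)
  then have bil: "cinner (J (\<pi> x *v J \<Omega>)) (\<pi> z *v \<Omega>) = trace (r ** x ** r ** z)" for x z
    by (simp add: J adj_mult ar as matrix_mul_assoc rs')
  obtain E where E: "\<And>x y. blinfun_apply \<psi> (kron x y) = trace (E y ** x)"
    using state_kron_functional [OF st] by metis
  have ex: "blinfun_apply \<psi> (kron x y) = trace (r ** x ** r ** (s ** E y ** s))" for x y
  proof -
    have "trace (r ** x ** r ** (s ** E y ** s)) = trace (r ** (x ** E y ** s))"
      by (simp add: matrix_mul_assoc rs')
    also have "\<dots> = trace (x ** E y)"
      by (subst trace_mul_sym) (simp add: sr flip: matrix_mul_assoc)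
    finally show ?thesis
      by (simp add: E trace_mul_sym [of x])
  qed
  have "\<exists>!\<tau>. \<forall>x y. blinfun_apply \<psi> (kron x y) = trace (r ** x ** r ** \<tau> y)"
  proof (rule ex1I)
    show "\<forall>x y. blinfun_apply \<psi> (kron x y) = trace (r ** x ** r ** (s ** E y ** s))"
      using ex by blast
    fix \<tau>
    assume \<tau>: "\<forall>x y. blinfun_apply \<psi> (kron x y) = trace (r ** x ** r ** \<tau> y)"
    show "\<tau> = (\<lambda>y. s ** E y ** s)"
    proof
      fix y
      show "\<tau> y = s ** E y ** s"
        using \<tau> ex by (intro trace_sandwich_cancel [OF sr rs]) metis
    qed
  qed
  from theI' [OF this] show ?thesis
    unfolding coupling_map_def bil by blast
qed

subsection \<open>Pure couplings and Jordan automorphisms\<close>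

lemma cinner_kron:
  fixes x y :: "complex^'n^'n"
  shows "cinner w (kron x y *v w) =
    trace (x ** (\<chi> i j. w $ (i, j)) ** transpose y ** adj (\<chi> i j. w $ (i, j)))"
proof -
  have "cinner w (kron x y *v w) = (\<Sum>(i, j)\<in>UNIV \<times> UNIV. \<Sum>(k, l)\<in>UNIV \<times> UNIV.
      x $ i $ k * w $ (k, l) * y $ j $ l * cnj (w $ (i, j)))"
    by (simp add: cinner_def matrix_vector_mult_def kron_nth case_prod_beta sum_distrib_left mult_ac)
  also have "\<dots> = (\<Sum>i\<in>UNIV. \<Sum>j\<in>UNIV. \<Sum>k\<in>UNIV. \<Sum>l\<in>UNIV.
      x $ i $ k * w $ (k, l) * y $ j $ l * cnj (w $ (i, j)))"
    by (simp only: sum.cartesian_product [symmetric])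
  also have "\<dots> = (\<Sum>i\<in>UNIV. \<Sum>j\<in>UNIV. \<Sum>l\<in>UNIV. \<Sum>k\<in>UNIV.
      x $ i $ k * w $ (k, l) * y $ j $ l * cnj (w $ (i, j)))"
    by (rule sum.cong [OF refl], rule sum.cong [OF refl], rule sum.swap)
  also have "\<dots> = trace (x ** (\<chi> i j. w $ (i, j)) ** transpose y ** adj (\<chi> i j. w $ (i, j)))"
    by (simp add: trace_def matrix_mult_nth adj_nth transpose_def sum_distrib_right)
  finally show ?thesis .
qed

lemma transpose_conjugation_jordan:
  fixes U :: "complex^'n^'n"
  assumes "U ** adj U = mat 1"
  shows "jordan_star_automorphism (\<lambda>y. U ** transpose y ** adj U)"
  unfolding jordan_star_automorphism_def
proof (intro conjI allI)
  have UU: "adj U ** U = mat 1"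
    using assms by (simp add: matrix_left_right_inverse)
  have UU': "A ** U ** adj U = A" "A ** adj U ** U = A" for A
    by (simp_all add: assms UU flip: matrix_mul_assoc)
  show "bij (\<lambda>y. U ** transpose y ** adj U)"
    by (rule o_bij [where g = "\<lambda>z. transpose (adj U ** z ** U)"])
      (auto simp: fun_eq_iff matrix_mul_assoc UU UU' assms)
  fix x y :: "complex^'n^'n" and c
  have T: "transpose (x + y) = transpose x + transpose y"
    "transpose (cscale c x) = cscale c (transpose x)"
    "transpose (adj x) = adj (transpose x)"
    by (rule matrix_ext, simp add: transpose_def cscale_nth adj_nth)+
  show "U ** transpose (x + y) ** adj U = U ** transpose x ** adj U + U ** transpose y ** adj U"
    by (simp add: T matrix_plus_ldistrib matrix_plus_rdistrib)
  show "U ** transpose (cscale c x) ** adj U = cscale c (U ** transpose x ** adj U)"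
    by (simp add: T cscale_mult_left cscale_mult_right)
  show "U ** transpose (adj x) ** adj U = adj (U ** transpose x ** adj U)"
    by (simp add: T adj_mult matrix_mul_assoc)
  have "transpose (x ** y + y ** x) = transpose x ** transpose y + transpose y ** transpose x"
    by (rule matrix_ext) (simp add: transpose_def matrix_mult_nth mult.commute)
  then show "U ** transpose (x ** y + y ** x) ** adj U =
      U ** transpose x ** adj U ** (U ** transpose y ** adj U) +
      U ** transpose y ** adj U ** (U ** transpose x ** adj U)"
    by (simp add: matrix_plus_ldistrib matrix_plus_rdistrib matrix_mul_assoc UU')
qed

lemma pure_state_imp_jordan:
  fixes r :: "complex^'n^'n"
  assumes r: "positive_operator r" and sr: "s ** r = mat 1" and rs: "r ** s = mat 1"
    and as: "adj s = s" and pure: "pure_state \<psi>"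
    and marginal: "\<And>x. blinfun_apply \<psi> (kron x (mat 1)) = trace (r ** r ** x)"
    and \<tau>: "\<And>x y. blinfun_apply \<psi> (kron x y) = trace (r ** x ** r ** \<tau> y)"
  shows "jordan_star_automorphism \<tau>"
proof -
  obtain w where w: "\<And>a. blinfun_apply \<psi> a = cinner w (a *v w)"
    using pure_state_vector [OF pure] by blast
  define V :: "complex^'n^'n" where "V = (\<chi> i j. w $ (i, j))"
  have V: "blinfun_apply \<psi> (kron x y) = trace (x ** V ** transpose y ** adj V)" for x y
    unfolding w V_def by (rule cinner_kron)
  have "trace (V ** adj V ** x) = trace (r ** r ** x)" for x
    using V [of x "mat 1"] marginal [of x] trace_mul_sym [of x "V ** adj V"]
    by (simp add: matrix_mul_assoc)
  then have VV: "V ** adj V = r ** r"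
    by (rule matrix_eq_trace)
  define U where "U = s ** V"
  have "U ** adj U = s ** (V ** adj V) ** s"
    by (simp add: U_def adj_mult as matrix_mul_assoc)
  also have "\<dots> = mat 1"
    unfolding VV by (simp add: matrix_mul_assoc sr rs)
  finally have UU: "U ** adj U = mat 1" .
  have "\<tau> y = U ** transpose y ** adj U" for y
  proof (rule trace_sandwich_cancel [OF sr rs])
    fix x
    have rs': "A ** r ** s = A" for A :: "complex^'n^'n"
      by (simp add: rs flip: matrix_mul_assoc)
    have "trace (r ** x ** r ** (U ** transpose y ** adj U)) =
        trace (r ** (x ** V ** transpose y ** adj V ** s))"
      by (simp add: U_def adj_mult as matrix_mul_assoc rs')
    also have "\<dots> = trace (x ** V ** transpose y ** adj V)"
      by (subst trace_mul_sym) (simp add: sr flip: matrix_mul_assoc)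
    finally show "trace (r ** x ** r ** \<tau> y) = trace (r ** x ** r ** (U ** transpose y ** adj U))"
      using V \<tau> by metis
  qed
  then have "\<tau> = (\<lambda>y. U ** transpose y ** adj U)"
    by blast
  then show ?thesis
    using transpose_conjugation_jordan [OF UU] by simp
qed

lemma state_adj_mult_eq_0:
  assumes "positive_operator D" "trace (D ** (adj a ** a)) = 0"
  shows "D ** adj a = 0" "a ** D = 0"
proof -
  have "trace (adj (adj a) ** D ** adj a) = 0"
    using assms(2) trace_mul_sym [of "D ** adj a" a] by (simp add: matrix_mul_assoc)
  then show "D ** adj a = 0"
    by (rule positive_congruence_null [OF assms(1)])
  from arg_cong [OF this, of adj] show "a ** D = 0"
    by (simp add: adj_mult positive_operator_hermitian [OF assms(1)])
qed

text \<open>If \<open>1 \<otimes> y - r \<tau>(y) s \<otimes> 1\<close> is in the left kernel of \<open>\<alpha>\<close> for all self-adjoint \<open>y\<close>, then the first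
  marginal of \<open>\<alpha>\<close> determines \<open>\<alpha>\<close> and satisfies the KMS condition of \<open>\<phi>\<close>, hence is \<open>\<phi>\<close>.\<close>

lemma state_eq_of_left_kernel:
  fixes r :: "complex^'n^'n"
  assumes ar: "adj r = r" and as: "adj s = s" and sr: "s ** r = mat 1" and rs: "r ** s = mat 1"
    and tr: "trace (r ** r) = 1"
    and jordan: "jordan_star_automorphism \<tau>" and st: "is_state \<alpha>"
    and kernel: "\<And>y a. adj y = y \<Longrightarrow> a = kron (mat 1) y - kron (r ** \<tau> y ** s) (mat 1) \<Longrightarrow>
      blinfun_apply \<alpha> (adj a ** a) = 0"
  shows "blinfun_apply \<alpha> (kron x y) = trace (r ** r ** (x ** r ** \<tau> y ** s))"
proof -
  have bij: "bij \<tau>" and \<tau>_add: "\<And>x y. \<tau> (x + y) = \<tau> x + \<tau> y"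
    and \<tau>_cscale: "\<And>c x. \<tau> (cscale c x) = cscale c (\<tau> x)" and \<tau>_adj: "\<And>x. \<tau> (adj x) = adj (\<tau> x)"
    using jordan by (auto simp: jordan_star_automorphism_def)
  obtain D where D: "positive_operator D" and \<alpha>: "\<And>a. blinfun_apply \<alpha> a = trace (D ** a)"
    using state_density [OF st] by blast
  have selfadj: "kron (mat 1) y ** D = kron (r ** \<tau> y ** s) (mat 1) ** D"
    "D ** kron (mat 1) y = D ** kron (s ** \<tau> y ** r) (mat 1)" if y: "adj y = y" for y
  proof -
    let ?a = "kron (mat 1) y - kron (r ** \<tau> y ** s) (mat 1)"
    have z: "trace (D ** (adj ?a ** ?a)) = 0"
      using kernel [OF y refl] by (simp add: \<alpha>)
    have "adj (\<tau> y) = \<tau> y"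
      using \<tau>_adj [of y] y by simp
    then have "adj ?a = kron (mat 1) y - kron (s ** \<tau> y ** r) (mat 1)"
      by (simp add: adj_diff adj_kron adj_mult ar as y matrix_mul_assoc)
    with state_adj_mult_eq_0 [OF D z]
    show "kron (mat 1) y ** D = kron (r ** \<tau> y ** s) (mat 1) ** D"
      "D ** kron (mat 1) y = D ** kron (s ** \<tau> y ** r) (mat 1)"
      by (simp_all add: matrix_diff_ldistrib matrix_diff_rdistrib)
  qed
  have comm: "kron (mat 1) y ** D = kron (r ** \<tau> y ** s) (mat 1) ** D"
    "D ** kron (mat 1) y = D ** kron (s ** \<tau> y ** r) (mat 1)" for y
  proof -
    define h where "h = cscale (1/2) (y + adj y)"
    define k where "k = cscale (- \<i> / 2) (y - adj y)"
    have h: "adj h = h" and k: "adj k = k" and y: "y = h + cscale \<i> k"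
      by (rule matrix_ext, simp add: h_def k_def adj_nth cscale_nth field_simps)+
    show "kron (mat 1) y ** D = kron (r ** \<tau> y ** s) (mat 1) ** D"
      "D ** kron (mat 1) y = D ** kron (s ** \<tau> y ** r) (mat 1)"
      unfolding y \<tau>_add \<tau>_cscale
      by (simp_all add: kron_add_right kron_add_left kron_cscale_left kron_cscale_right
          matrix_plus_ldistrib matrix_plus_rdistrib cscale_mult_left cscale_mult_right
          selfadj [OF h] selfadj [OF k])
  qed
  obtain M where M: "\<And>x. blinfun_apply \<alpha> (kron x (mat 1)) = trace (M ** x)"
    using state_kron_functional [OF st] by blast
  have left: "blinfun_apply \<alpha> (kron x y) = trace (M ** (x ** (r ** \<tau> y ** s)))" for x y
  proof -
    have "blinfun_apply \<alpha> (kron x y) = trace (D ** kron x (mat 1) ** kron (mat 1) y)"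
      by (simp add: \<alpha> kron_mult flip: matrix_mul_assoc)
    also have "\<dots> = trace (kron (mat 1) y ** D ** kron x (mat 1))"
      by (subst trace_mul_sym) (simp add: matrix_mul_assoc)
    also have "\<dots> = trace (kron (r ** \<tau> y ** s) (mat 1) ** (D ** kron x (mat 1)))"
      by (simp add: comm matrix_mul_assoc)
    also have "\<dots> = trace (D ** kron (x ** (r ** \<tau> y ** s)) (mat 1))"
      by (subst trace_mul_sym) (simp add: kron_mult flip: matrix_mul_assoc)
    finally show ?thesis
      by (simp only: \<alpha> [symmetric] M)
  qed
  have right: "blinfun_apply \<alpha> (kron x y) = trace (M ** (s ** \<tau> y ** r ** x))" for x y
  proof -
    have "blinfun_apply \<alpha> (kron x y) = trace (D ** kron (mat 1) y ** kron x (mat 1))"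
      by (simp add: \<alpha> kron_mult flip: matrix_mul_assoc)
    also have "\<dots> = trace (D ** kron (s ** \<tau> y ** r ** x) (mat 1))"
      unfolding comm by (simp add: kron_mult flip: matrix_mul_assoc)
    finally show ?thesis
      by (simp only: \<alpha> [symmetric] M)
  qed
  have "z ** (s ** M ** s) = (s ** M ** s) ** z" for z
  proof -
    obtain y where y: "z = \<tau> y"
      using bij by (metis bij_pointE)
    have "trace (r ** z ** s ** M ** x) = trace (M ** s ** z ** r ** x)" for x
    proof -
      have "trace (r ** z ** s ** (M ** x)) = trace (M ** (x ** (r ** z ** s)))"
        by (subst trace_mul_sym) (simp add: matrix_mul_assoc)
      then show ?thesis
        using left [of x y] right [of x y] by (simp add: y matrix_mul_assoc)
    qed
    then have "r ** z ** s ** M = M ** s ** z ** r"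
      by (rule matrix_eq_trace)
    then have "s ** (r ** z ** s ** M) ** s = s ** (M ** s ** z ** r) ** s"
      by simp
    also have "s ** (r ** z ** s ** M) ** s = z ** (s ** M ** s)"
      by (simp add: matrix_mul_assoc sr)
    also have "s ** (M ** s ** z ** r) ** s = s ** M ** s ** z"
      by (simp add: rs flip: matrix_mul_assoc)
    finally show ?thesis .
  qed
  then obtain c where c: "s ** M ** s = cscale c (mat 1)"
    using central_matrix [of "s ** M ** s"] by blast
  have "M = r ** (s ** M ** s) ** r"
    by (simp add: matrix_mul_assoc rs) (simp add: sr flip: matrix_mul_assoc)
  also have "\<dots> = cscale c (r ** r)"
    by (simp add: c cscale_mult_left cscale_mult_right)
  finally have Mc: "M = cscale c (r ** r)" .
  have "trace M = 1"
    using M [of "mat 1"] st by (simp add: kron_mat_1 is_state_def)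
  then have "c = 1"
    by (simp add: Mc trace_cscale tr)
  then show ?thesis
    by (simp add: left Mc matrix_mul_assoc)
qed

lemma jordan_imp_pure_state:
  fixes r :: "complex^'n^'n" and \<psi> :: "(complex^('n \<times> 'n)^('n \<times> 'n)) \<Rightarrow>\<^sub>L complex"
  assumes ar: "adj r = r" and as: "adj s = s" and sr: "s ** r = mat 1" and rs: "r ** s = mat 1"
    and st: "is_state \<psi>"
    and marginal: "\<And>x. blinfun_apply \<psi> (kron x (mat 1)) = trace (r ** r ** x)"
    and \<tau>: "\<And>x y. blinfun_apply \<psi> (kron x y) = trace (r ** x ** r ** \<tau> y)"
    and jordan: "jordan_star_automorphism \<tau>"
  shows "pure_state \<psi>"
proof -
  have tr: "trace (r ** r) = 1"
    using st marginal [of "mat 1"] by (simp add: is_state_def kron_mat_1)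
  have sr': "A ** s ** r = A" and rs': "A ** r ** s = A" for A :: "complex^'n^'n"
    by (simp_all add: sr rs flip: matrix_mul_assoc)
  have \<tau>1: "\<tau> (mat 1) = mat 1"
  proof (rule trace_sandwich_cancel [OF sr rs])
    fix x
    show "trace (r ** x ** r ** \<tau> (mat 1)) = trace (r ** x ** r ** mat 1)"
      using \<tau> [of x "mat 1"] marginal [of x] trace_mul_sym [of r "r ** x"]
      by (simp add: matrix_mul_assoc)
  qed
  have kernel: "blinfun_apply \<psi> (adj a ** a) = 0"
    if y: "adj y = y" and a: "a = kron (mat 1) y - kron (r ** \<tau> y ** s) (mat 1)" for y a
  proof -
    define t where "t = \<tau> y"
    have "\<tau> (adj y) = adj (\<tau> y)"
      using jordan by (auto simp: jordan_star_automorphism_def)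
    then have at: "adj t = t"
      using y by (simp add: t_def)
    have "\<tau> (y ** y + y ** y) = \<tau> (y ** y) + \<tau> (y ** y)" "\<tau> (y ** y + y ** y) = t ** t + t ** t"
      using jordan unfolding jordan_star_automorphism_def t_def by blast+
    then have "2 *\<^sub>R \<tau> (y ** y) = 2 *\<^sub>R (t ** t)"
      by (simp only: scaleR_2)
    then have tt: "\<tau> (y ** y) = t ** t"
      by simp
    have aa: "adj a = kron (mat 1) y - kron (s ** t ** r) (mat 1)"
      by (simp add: a t_def [symmetric] adj_diff adj_kron adj_mult ar as at y matrix_mul_assoc)
    have "adj a ** a = kron (mat 1) (y ** y) - kron (r ** t ** s) y - kron (s ** t ** r) y
        + kron (s ** t ** r ** (r ** t ** s)) (mat 1)"
      unfolding aa unfolding a t_def [symmetric]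
      by (simp add: matrix_diff_ldistrib matrix_diff_rdistrib kron_mult algebra_simps)
    then have "blinfun_apply \<psi> (adj a ** a) =
        trace (r ** mat 1 ** r ** (t ** t)) - trace (r ** (r ** t ** s) ** r ** t)
        - trace (r ** (s ** t ** r) ** r ** t)
        + trace (r ** (s ** t ** r ** (r ** t ** s)) ** r ** mat 1)"
      by (simp only: blinfun.add_right blinfun.diff_right \<tau> tt \<tau>1 t_def [symmetric])
    also have "r ** mat 1 ** r ** (t ** t) = r ** r ** t ** t"
      by (simp add: matrix_mul_assoc)
    also have "r ** (r ** t ** s) ** r ** t = r ** r ** t ** t"
      by (simp add: matrix_mul_assoc sr')
    also have "r ** (s ** t ** r) ** r ** t = t ** (r ** r ** t)"
      by (simp add: matrix_mul_assoc rs)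
    also have "r ** (s ** t ** r ** (r ** t ** s)) ** r ** mat 1 = t ** (r ** r ** t)"
      by (simp add: matrix_mul_assoc rs sr')
    also have "trace (t ** (r ** r ** t)) = trace (r ** r ** t ** t)"
      by (rule trace_mul_sym)
    finally show ?thesis by simp
  qed
  have unique: "\<alpha> = \<beta>" if \<alpha>: "is_state \<alpha>" and \<beta>: "is_state \<beta>" and u: "0 < u" "u < 1"
    and eq: "\<psi> = (1 - u) *\<^sub>R \<alpha> + u *\<^sub>R \<beta>" for \<alpha> \<beta> u
  proof -
    have zero: "blinfun_apply \<alpha> (adj a ** a) = 0 \<and> blinfun_apply \<beta> (adj a ** a) = 0"
      if 0: "blinfun_apply \<psi> (adj a ** a) = 0" for a :: "complex^('n \<times> 'n)^('n \<times> 'n)"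
    proof -
      have A: "blinfun_apply \<alpha> (adj a ** a) \<in> \<real>\<^sub>\<ge>\<^sub>0" and B: "blinfun_apply \<beta> (adj a ** a) \<in> \<real>\<^sub>\<ge>\<^sub>0"
        using \<alpha> \<beta> by (simp_all add: is_state_def)
      have "(1 - u) * Re (blinfun_apply \<alpha> (adj a ** a)) + u * Re (blinfun_apply \<beta> (adj a ** a)) = 0"
        using arg_cong [OF 0, of Re] by (simp add: eq blinfun.add_left blinfun.scaleR_left)
      then have "Re (blinfun_apply \<alpha> (adj a ** a)) = 0 \<and> Re (blinfun_apply \<beta> (adj a ** a)) = 0"
        using A B u by (subst (asm) add_nonneg_eq_0_iff) (auto simp: complex_nonneg_Reals_iff)
      then show ?thesis
        using A B by (simp add: complex_nonneg_Reals_iff complex_eq_iff)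
    qed
    have "blinfun_apply \<alpha> (kron x y) = trace (r ** r ** (x ** r ** \<tau> y ** s))" for x y
      by (rule state_eq_of_left_kernel [OF ar as sr rs tr jordan \<alpha>]) (simp add: kernel zero)
    moreover have "blinfun_apply \<beta> (kron x y) = trace (r ** r ** (x ** r ** \<tau> y ** s))" for x y
      by (rule state_eq_of_left_kernel [OF ar as sr rs tr jordan \<beta>]) (simp add: kernel zero)
    ultimately have k: "blinfun_apply \<alpha> (kron x y) = blinfun_apply \<beta> (kron x y)" for x y
      by simp
    obtain A where A: "\<And>a. blinfun_apply \<alpha> a = trace (A ** a)"
      using state_density [OF \<alpha>] by blast
    obtain B where B: "\<And>a. blinfun_apply \<beta> a = trace (B ** a)"
      using state_density [OF \<beta>] by blast
    have "A = B"
      using k by (intro matrix_eq_trace_kron) (simp only: A B)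
    then show ?thesis
      by (intro blinfun_eqI) (simp add: A B)
  qed
  then show ?thesis
    using st unfolding pure_state_def extreme_point_of_def in_segment by blast
qed

theorem theorem6p1:
  fixes \<phi> :: "(complex^'n^'n) \<Rightarrow>\<^sub>L complex"
    and \<psi> :: "(complex^('n \<times> 'n)^('n \<times> 'n)) \<Rightarrow>\<^sub>L complex"
    and \<pi> :: "complex^'n^'n \<Rightarrow> complex^'h^'h"
    and \<Omega> :: "complex^'h"
    and J :: "complex^'h \<Rightarrow> complex^'h"
  assumes "faithful_state \<phi>"
    and "standard_form \<phi> \<pi> \<Omega>"
    and "tomita_conjugation \<pi> \<Omega> J"
    and "\<psi> extreme_point_of couplings \<phi>"
  shows "pure_state \<psi> \<longleftrightarrow> jordan_star_automorphism (coupling_map \<pi> \<Omega> J \<psi>)"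
proof -
  obtain r s where r: "positive_operator r" "s ** r = mat 1" "r ** s = mat 1" "adj s = s"
    and \<phi>: "\<And>a. blinfun_apply \<phi> a = trace (r ** r ** a)"
    using faithful_state_sqrt_density [OF assms(1)] by blast
  have st: "is_state \<psi>" and marginal: "\<And>x. blinfun_apply \<psi> (kron x (mat 1)) = trace (r ** r ** x)"
    using assms(4) by (auto simp: extreme_point_of_def couplings_def \<phi>)
  note \<tau> = coupling_map_eq [OF assms(2,3) r \<phi> st]
  show ?thesis
    using pure_state_imp_jordan [OF r _ marginal \<tau>]
      jordan_imp_pure_state [OF positive_operator_hermitian [OF r(1)] r(4,2,3) st marginal \<tau>]
    by blast
qed

end
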